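(* For every $\tau\in\mathbb{H}^2$, $$\theta'[0,\tfrac14](0,\tau)=-\pi\,\theta[0,\tfrac14](0,\tau)\,\theta[1,0](0,4\tau)\left\{\sqrt2\,\theta[0,0](0,2\tau)-\theta[1,0](0,4\tau)\right\}$$ and $$\theta'[0,\tfrac34](0,\tau)=-\pi\,\theta[0,\tfrac34](0,\tau)\,\theta[1,0](0,4\tau)\left\{\sqrt2\,\theta[0,0](0,2\tau)+\theta[1,0](0,4\tau)\right\}.$$
   Context: $\mathbb{H}^2=\{\tau\in\mathbb{C} : \Im\tau>0\}$ is the upper half plane. For $\epsilon,\epsilon'\in\mathbb{R}$, $\zeta\in\mathbb{C}$, $\tau\in\mathbb{H}^2$, the theta function with characteristics is $$\theta[\epsilon,\epsilon'](\zeta,\tau)=\sum_{n\in\mathbb{Z}}\exp\left(2\pi i\left[\tfrac12\left(n+\tfrac{\epsilon}{2}\right)^2\tau+\left(n+\tfrac{\epsilon}{2}\right)\left(\zeta+\tfrac{\epsilon'}{2}\right)\right]\right),$$ and $\theta'[\epsilon,\epsilon'](0,\tau)=\frac{\partial}{\partial\zeta}\theta[\epsilon,\epsilon'](\zeta,\tau)\big|_{\zeta=0}$. *)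

theory Defs
  imports "HOL-Analysis.Analysis"
begin

text \<open>
  Theta function with real characteristics. The series converges absolutely when
  \<open>Im \<tau> > 0\<close>, so the bilateral sum is the unordered sum over all integers; outside the
  upper half plane the value is immaterial.
\<close>

definition theta :: "real \<Rightarrow> real \<Rightarrow> complex \<Rightarrow> complex \<Rightarrow> complex" where
  "theta \<epsilon> \<epsilon>' \<zeta> \<tau> =
    (\<Sum>\<^sub>\<infinity>n\<in>(UNIV :: int set).
      exp (2 * of_real pi * \<i> *
        (1 / 2 * (of_int n + of_real \<epsilon> / 2)\<^sup>2 * \<tau>
          + (of_int n + of_real \<epsilon> / 2) * (\<zeta> + of_real \<epsilon>' / 2))))"

definition theta_deriv :: "real \<Rightarrow> real \<Rightarrow> complex \<Rightarrow> complex \<Rightarrow> complex" where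
  "theta_deriv \<epsilon> \<epsilon>' \<zeta> \<tau> = deriv (\<lambda>z. theta \<epsilon> \<epsilon>' z \<tau>) \<zeta>"

end

theory Submission
  imports Defs "HOL-Complex_Analysis.Complex_Analysis"
begin

text \<open>
  Write \<open>\<theta>\<^sub>3(\<zeta>)\<close> for the theta function with characteristics 0 and 0, and
  \<open>\<theta>\<^sub>2(\<zeta>)\<close> for that with 1 and 0. The second characteristic is a translation,
  so the claims concern the logarithmic derivatives \<open>a\<close> and \<open>b\<close> of \<open>\<theta>\<^sub>3\<close>
  at \<open>1 / 8\<close> and \<open>3 / 8\<close>. Both follow from

    \<open>a - b = 2 \<pi> \<theta>\<^sub>2(0, 4 \<tau>)\<^sup>2\<close> and
    \<open>a + b = - 2 \<pi> sqrt 2 \<theta>\<^sub>2(0, 4 \<tau>) \<theta>\<^sub>3(0, 2 \<tau>)\<close>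

  (\<open>theta3_eighths_wronskian\<close> and \<open>theta3_eighths_product_deriv\<close>). These arise by
  differentiating two instances of the addition formula \<open>theta_mult\<close>, which is a
  rearrangement of a double series. In both cases the outcome is expressed through the derivative
  \<open>\<theta>\<^sub>2'(1 / 2)\<close>, which is \<open>\<theta>\<^sub>1'(0)\<close> up to sign, at a multiple of
  \<open>\<tau>\<close>.

  Addition formulas relate such derivatives only to one another; a limiting argument in
  \<open>\<tau>\<close> turns this one into a product of theta constants. The quotient of the two sides
  of Jacobi's formula \<open>\<theta>\<^sub>1' = \<pi> \<theta>\<^sub>2 \<theta>\<^sub>3 \<theta>\<^sub>4\<close> is
  invariant under \<open>\<tau> \<mapsto> 2 \<tau>\<close> by duplication formulas. Iterating moves
  \<open>\<tau>\<close> to \<open>\<i> \<infinity>\<close>, where the leading terms give its value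
  (\<open>doubling_invariant_eq_limit\<close>, \<open>jacobi_derivative_formula\<close>). The same device
  evaluates \<open>\<theta>\<^sub>2(0) \<theta>\<^sub>2(1 / 4)\<close> (\<open>theta2_mult_quarter\<close>), which is
  the source of the \<open>sqrt 2\<close>, and shows that no theta constant in a denominator vanishes
  (\<open>theta_constants_nonzero\<close>).
\<close>

section \<open>Convergence and holomorphy\<close>

lemma summable_on_int_exp_neg_abs: "(\<lambda>n::int. exp (- \<bar>real_of_int n\<bar>)) summable_on UNIV"
proof -
  have nat: "(\<lambda>k::nat. exp (- real k)) summable_on UNIV"
  proof -
    have "summable (\<lambda>k::nat. exp (-1::real) ^ k)"
      by (rule summable_geometric) simp
    then show ?thesis
      by (subst summable_on_UNIV_nonneg_real_iff) (simp_all add: exp_of_nat_mult [symmetric])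
  qed
  have "(\<lambda>n::int. exp (- \<bar>real_of_int n\<bar>)) summable_on (range int \<union> range (\<lambda>k. - int k))"
    by (intro summable_on_union; subst summable_on_reindex)
       (use nat in \<open>auto simp: inj_on_def o_def\<close>)
  moreover have "range int \<union> range (\<lambda>k. - int k) = UNIV"
    by (auto simp: image_iff) (metis int_cases2)
  ultimately show ?thesis by simp
qed

text \<open>
  Completing the square bounds the exponent by a constant minus \<open>\<bar>n\<bar>\<close>. The linear term
  \<open>R\<close> leaves room for \<open>\<zeta>\<close> to vary over a horizontal strip, so this series is
  the majorant in every uniform estimate on theta series.
\<close>

lemma gaussian_summable_on_int:
  fixes c R y :: real
  assumes "y > 0"
  shows "(\<lambda>n::int. exp (R * \<bar>of_int n + c\<bar> - y * (of_int n + c)\<^sup>2)) summable_on UNIV"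
proof (rule summable_on_comparison_test)
  let ?K = "(R + 1)\<^sup>2 / (4 * y) + \<bar>c\<bar>"
  show "(\<lambda>n::int. exp ?K * exp (- \<bar>real_of_int n\<bar>)) summable_on UNIV"
    by (intro summable_on_cmult_right summable_on_int_exp_neg_abs)
  fix n :: int
  define s where "s = \<bar>of_int n + c\<bar>"
  have "0 \<le> (2 * y * s - (R + 1))\<^sup>2 / (4 * y)"
    using assms by simp
  also have "\<dots> = y * s\<^sup>2 - (R + 1) * s + (R + 1)\<^sup>2 / (4 * y)"
    using assms by (simp add: field_simps power2_eq_square)
  finally have "R * s - y * s\<^sup>2 \<le> (R + 1)\<^sup>2 / (4 * y) - s"
    by (simp add: algebra_simps)
  moreover have "\<bar>real_of_int n\<bar> \<le> s + \<bar>c\<bar>"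
    unfolding s_def by linarith
  ultimately have "R * s - y * s\<^sup>2 \<le> ?K - \<bar>real_of_int n\<bar>"
    by linarith
  then show "exp (R * \<bar>of_int n + c\<bar> - y * (of_int n + c)\<^sup>2) \<le> exp ?K * exp (- \<bar>real_of_int n\<bar>)"
    by (simp add: s_def flip: exp_add)
qed simp

text \<open>
  The second characteristic only translates \<open>\<zeta>\<close>, so the summand is isolated with
  \<open>\<epsilon>' = 0\<close>; every identity is stated in this form and evaluated at a shifted point.
\<close>

definition theta_term :: "real \<Rightarrow> complex \<Rightarrow> complex \<Rightarrow> int \<Rightarrow> complex" where
  "theta_term \<epsilon> \<zeta> \<tau> n =
    exp (2 * of_real pi * \<i> *
      (1 / 2 * (of_int n + of_real \<epsilon> / 2)\<^sup>2 * \<tau> + (of_int n + of_real \<epsilon> / 2) * \<zeta>))"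

lemma theta_eq_infsum: "theta \<epsilon> 0 \<zeta> \<tau> = infsum (theta_term \<epsilon> \<zeta> \<tau>) UNIV"
  by (simp add: theta_def theta_term_def [abs_def])

lemma theta_characteristic_shift: "theta \<epsilon> \<epsilon>' \<zeta> \<tau> = theta \<epsilon> 0 (\<zeta> + of_real \<epsilon>' / 2) \<tau>"
  by (simp add: theta_def)

lemma norm_theta_term:
  "norm (theta_term \<epsilon> \<zeta> \<tau> n) =
     exp (- (2 * pi * (of_int n + \<epsilon> / 2) * Im \<zeta>) - pi * Im \<tau> * (of_int n + \<epsilon> / 2)\<^sup>2)"
proof -
  define s where "s = of_int n + \<epsilon> / 2"
  have "of_int n + of_real \<epsilon> / 2 = complex_of_real s"
    by (simp add: s_def)
  then have "norm (theta_term \<epsilon> \<zeta> \<tau> n) =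
      exp (Re (2 * of_real pi * \<i> * (1 / 2 * (of_real s)\<^sup>2 * \<tau> + of_real s * \<zeta>)))"
    unfolding theta_term_def by (simp only: norm_exp_eq_Re)
  also have "\<dots> = exp (- (2 * pi * s * Im \<zeta>) - pi * Im \<tau> * s\<^sup>2)"
    by (simp add: power2_eq_square algebra_simps)
  finally show ?thesis
    by (simp add: s_def)
qed

lemma norm_theta_term_le:
  assumes "\<bar>Im \<zeta>\<bar> \<le> R"
  shows "norm (theta_term \<epsilon> \<zeta> \<tau> n) \<le>
    exp (2 * pi * R * \<bar>of_int n + \<epsilon> / 2\<bar> - pi * Im \<tau> * (of_int n + \<epsilon> / 2)\<^sup>2)"
proof -
  define s where "s = of_int n + \<epsilon> / 2"
  have "- (s * Im \<zeta>) \<le> \<bar>s\<bar> * R"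
    using assms mult_left_mono [OF assms, of "\<bar>s\<bar>"] by (simp add: abs_mult [symmetric])
  then have "- (2 * pi * s * Im \<zeta>) \<le> 2 * pi * R * \<bar>s\<bar>"
    using mult_left_mono [of "- (s * Im \<zeta>)" "\<bar>s\<bar> * R" "2 * pi"] by (simp add: mult_ac)
  then show ?thesis
    unfolding norm_theta_term s_def [symmetric] by simp
qed

lemma theta_term_abs_summable:
  assumes "Im \<tau> > 0"
  shows "(\<lambda>n. norm (theta_term \<epsilon> \<zeta> \<tau> n)) summable_on UNIV"
proof (rule Infinite_Sum.abs_summable_on_comparison_test')
  show "(\<lambda>n::int. exp (2 * pi * \<bar>Im \<zeta>\<bar> * \<bar>of_int n + \<epsilon> / 2\<bar> - pi * Im \<tau> * (of_int n + \<epsilon> / 2)\<^sup>2))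
          summable_on UNIV"
    using assms by (intro gaussian_summable_on_int) simp
qed (rule norm_theta_term_le, simp)

lemma theta_term_summable:
  "Im \<tau> > 0 \<Longrightarrow> theta_term \<epsilon> \<zeta> \<tau> summable_on UNIV"
  by (rule abs_summable_summable) (rule theta_term_abs_summable)

lemma theta_holomorphic:
  assumes "Im \<tau> > 0"
  shows "(\<lambda>\<zeta>. theta \<epsilon> 0 \<zeta> \<tau>) holomorphic_on UNIV"
proof -
  have "(\<lambda>\<zeta>. theta \<epsilon> 0 \<zeta> \<tau>) holomorphic_on ball z 1" for z
  proof -
    let ?R = "\<bar>Im z\<bar> + 1"
    have ulim: "uniform_limit (cball z 1) (\<lambda>X \<zeta>. \<Sum>n\<in>X. theta_term \<epsilon> \<zeta> \<tau> n)
            (\<lambda>\<zeta>. infsum (\<lambda>n. theta_term \<epsilon> \<zeta> \<tau> n) UNIV) (finite_subsets_at_top UNIV)"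
    proof (rule Weierstrass_m_test_general)
      show "(\<lambda>n::int. exp (2 * pi * ?R * \<bar>of_int n + \<epsilon> / 2\<bar> - pi * Im \<tau> * (of_int n + \<epsilon> / 2)\<^sup>2))
          summable_on UNIV"
        using assms by (intro gaussian_summable_on_int) simp
      fix n \<zeta> assume "\<zeta> \<in> cball z 1"
      then have "\<bar>Im (z - \<zeta>)\<bar> \<le> 1"
        using abs_Im_le_cmod [of "z - \<zeta>"] by (simp add: dist_norm)
      then show "norm (theta_term \<epsilon> \<zeta> \<tau> n) \<le>
          exp (2 * pi * ?R * \<bar>of_int n + \<epsilon> / 2\<bar> - pi * Im \<tau> * (of_int n + \<epsilon> / 2)\<^sup>2)"
        by (intro norm_theta_term_le) simp
    qed
    have "\<forall>\<^sub>F X in finite_subsets_at_top UNIV.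
        continuous_on (cball z 1) (\<lambda>\<zeta>. \<Sum>n\<in>X. theta_term \<epsilon> \<zeta> \<tau> n) \<and>
        (\<lambda>\<zeta>. \<Sum>n\<in>X. theta_term \<epsilon> \<zeta> \<tau> n) holomorphic_on ball z 1"
      by (auto simp: theta_term_def intro!: always_eventually continuous_intros holomorphic_intros)
    then show ?thesis
      by (rule holomorphic_uniform_limit [OF _ ulim]) (simp_all add: theta_eq_infsum)
  qed
  then show ?thesis
    by (meson UNIV_I centre_in_ball holomorphic_on_def holomorphic_on_imp_differentiable_at
        open_ball field_differentiable_at_within zero_less_one)
qed

lemma theta_has_derivative:
  assumes "Im \<tau> > 0"
  shows "((\<lambda>\<zeta>. theta \<epsilon> 0 \<zeta> \<tau>) has_field_derivative deriv (\<lambda>\<zeta>. theta \<epsilon> 0 \<zeta> \<tau>) z) (at z)"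
  using theta_holomorphic [OF assms] by (rule holomorphic_derivI) auto

lemma theta_has_derivative_chain [derivative_intros]:
  assumes "Im \<tau> > 0" "(g has_field_derivative d) (at x)"
  shows "((\<lambda>x. theta \<epsilon> 0 (g x) \<tau>) has_field_derivative theta_deriv \<epsilon> 0 (g x) \<tau> * d) (at x)"
  unfolding theta_deriv_def using theta_has_derivative [OF assms(1)] assms(2) by (rule DERIV_chain2)

lemma theta_deriv_characteristic_shift:
  assumes "Im \<tau> > 0"
  shows "theta_deriv \<epsilon> \<epsilon>' \<zeta> \<tau> = theta_deriv \<epsilon> 0 (\<zeta> + of_real \<epsilon>' / 2) \<tau>"
proof -
  have "((\<lambda>z. theta \<epsilon> 0 (z + of_real \<epsilon>' / 2) \<tau>) has_field_derivative
      theta_deriv \<epsilon> 0 (\<zeta> + of_real \<epsilon>' / 2) \<tau> * 1) (at \<zeta>)"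
    using assms by (intro theta_has_derivative_chain) (auto intro!: derivative_eq_intros)
  then show ?thesis
    unfolding theta_deriv_def [of \<epsilon> \<epsilon>'] theta_characteristic_shift [of \<epsilon> \<epsilon>'] by (simp add: DERIV_imp_deriv)
qed

section \<open>Symmetries and addition formulas\<close>

lemma theta_char_plus_2: "theta (\<epsilon> + 2) 0 \<zeta> \<tau> = theta \<epsilon> 0 \<zeta> \<tau>"
  unfolding theta_eq_infsum
  by (rule infsum_reindex_bij_witness [of _ "\<lambda>n. n - 1" "\<lambda>n. n + 1"])
     (auto simp: theta_term_def add_divide_distrib algebra_simps)

lemma theta_uminus: "theta (- \<epsilon>) 0 (- \<zeta>) \<tau> = theta \<epsilon> 0 \<zeta> \<tau>"
  unfolding theta_eq_infsum
  by (rule infsum_reindex_bij_witness [of _ uminus uminus])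
     (auto simp: theta_term_def power2_eq_square algebra_simps)

lemma theta_term_plus_1:
  "theta_term \<epsilon> (\<zeta> + 1) \<tau> n = exp (of_real pi * \<i> * of_real \<epsilon>) * theta_term \<epsilon> \<zeta> \<tau> n"
proof -
  have "theta_term \<epsilon> (\<zeta> + 1) \<tau> n =
      exp (of_real pi * \<i> * of_real \<epsilon>) * theta_term \<epsilon> \<zeta> \<tau> n * exp (2 * of_real pi * \<i> * of_int n)"
    unfolding theta_term_def exp_add [symmetric] by (rule arg_cong [of _ _ exp]) (simp add: algebra_simps)
  also have "exp (2 * of_real pi * \<i> * of_int n) = 1"
    using exp_integer_2pi [of "of_int n"] by (simp add: mult_ac)
  finally show ?thesis by simp
qed

lemma theta_plus_1: "theta \<epsilon> 0 (\<zeta> + 1) \<tau> = exp (of_real pi * \<i> * of_real \<epsilon>) * theta \<epsilon> 0 \<zeta> \<tau>"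
  unfolding theta_eq_infsum theta_term_plus_1 by (rule infsum_cmult_right')

lemma theta_term_mult:
  "theta_term \<epsilon> \<zeta> \<tau> (a + b + j) * theta_term \<delta> \<xi> \<tau> (a - b) =
   theta_term ((\<epsilon> + \<delta>) / 2 + of_int j) (\<zeta> + \<xi>) (2 * \<tau>) a *
   theta_term ((\<epsilon> - \<delta>) / 2 + of_int j) (\<zeta> - \<xi>) (2 * \<tau>) b"
  unfolding theta_term_def exp_add [symmetric]
  by (rule arg_cong [of _ _ exp]) (simp add: field_simps power2_eq_square)

lemma infsum_mult_abs_summable:
  fixes f g :: "int \<Rightarrow> complex"
  assumes "(\<lambda>m. norm (f m)) summable_on A" "(\<lambda>n. norm (g n)) summable_on B"
  shows "(\<lambda>(m, n). f m * g n) summable_on A \<times> B"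
    and "infsum f A * infsum g B = infsum (\<lambda>(m, n). f m * g n) (A \<times> B)"
proof -
  have "(\<lambda>p. norm ((\<lambda>(m, n). f m * g n) p)) summable_on A \<times> B"
    using assms
    by (subst Infinite_Sum.abs_summable_on_Sigma_iff)
       (auto simp: norm_mult infsum_cmult_right' abs_mult intro!: summable_on_cmult_right summable_on_cmult_left)
  then show s: "(\<lambda>(m, n). f m * g n) summable_on A \<times> B"
    by (rule abs_summable_summable)
  show "infsum f A * infsum g B = infsum (\<lambda>(m, n). f m * g n) (A \<times> B)"
    by (subst infsum_Sigma'_banach [OF s, symmetric]) (simp add: infsum_cmult_right' infsum_cmult_left')
qed

text \<open>
  The double series on the left is summed over \<open>\<int>\<^sup>2\<close>. The substitution
  \<open>(m, n) = (a + b + j, a - b)\<close> with \<open>j \<in> {0, 1}\<close> according to the parity of \<open>m - n\<close>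
  diagonalises the form \<open>m\<^sup>2 + n\<^sup>2\<close> into \<open>2 a\<^sup>2 + 2 b\<^sup>2\<close>,
  up to shifts, which is why each parity class factors into two theta series at \<open>2 \<tau>\<close>.
\<close>

theorem theta_mult:
  assumes "Im \<tau> > 0"
  shows "theta \<epsilon> 0 \<zeta> \<tau> * theta \<delta> 0 \<xi> \<tau> =
     theta ((\<epsilon> + \<delta>) / 2) 0 (\<zeta> + \<xi>) (2 * \<tau>) * theta ((\<epsilon> - \<delta>) / 2) 0 (\<zeta> - \<xi>) (2 * \<tau>)
   + theta ((\<epsilon> + \<delta>) / 2 + 1) 0 (\<zeta> + \<xi>) (2 * \<tau>) * theta ((\<epsilon> - \<delta>) / 2 + 1) 0 (\<zeta> - \<xi>) (2 * \<tau>)"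
proof -
  define F where "F = (\<lambda>(m, n). theta_term \<epsilon> \<zeta> \<tau> m * theta_term \<delta> \<xi> \<tau> n)"
  define h where "h j = (\<lambda>(a, b). (a + b + j, a - b))" for j :: int
  have F: "F summable_on UNIV" "theta \<epsilon> 0 \<zeta> \<tau> * theta \<delta> 0 \<xi> \<tau> = infsum F UNIV"
    using infsum_mult_abs_summable [OF theta_term_abs_summable theta_term_abs_summable, OF assms assms]
    by (simp_all add: F_def theta_eq_infsum)
  have inj: "inj (h j)" for j
    by (auto simp: h_def inj_on_def)
  have coset: "infsum F (range (h j)) =
      theta ((\<epsilon> + \<delta>) / 2 + of_int j) 0 (\<zeta> + \<xi>) (2 * \<tau>) * theta ((\<epsilon> - \<delta>) / 2 + of_int j) 0 (\<zeta> - \<xi>) (2 * \<tau>)"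
    for j
  proof -
    have "infsum F (range (h j)) = infsum (F \<circ> h j) UNIV"
      using inj by (rule infsum_reindex)
    also have "F \<circ> h j = (\<lambda>(a, b). theta_term ((\<epsilon> + \<delta>) / 2 + of_int j) (\<zeta> + \<xi>) (2 * \<tau>) a *
        theta_term ((\<epsilon> - \<delta>) / 2 + of_int j) (\<zeta> - \<xi>) (2 * \<tau>) b)"
      by (auto simp: F_def h_def fun_eq_iff theta_term_mult)
    also have "infsum \<dots> UNIV = theta ((\<epsilon> + \<delta>) / 2 + of_int j) 0 (\<zeta> + \<xi>) (2 * \<tau>) *
        theta ((\<epsilon> - \<delta>) / 2 + of_int j) 0 (\<zeta> - \<xi>) (2 * \<tau>)"
      using infsum_mult_abs_summable(2) [OF theta_term_abs_summable theta_term_abs_summable,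
          of "2 * \<tau>" "2 * \<tau>"] assms
      by (simp add: theta_eq_infsum)
    finally show ?thesis .
  qed
  have range: "range (h j) = {(m, n). even (m - n - j)}" for j
  proof (intro equalityI subsetI)
    fix x assume "x \<in> {(m, n). even (m - n - j)}"
    then obtain m n where mn: "x = (m, n)" "even (m - n - j)"
      by (cases x) auto
    from mn(2) obtain k where "m - n - j = 2 * k" ..
    with mn(1) have "x = h j (n + k, k)"
      by (simp add: h_def algebra_simps)
    then show "x \<in> range (h j)" by simp
  qed (auto simp: h_def)
  have "UNIV = range (h 0) \<union> range (h 1)" "range (h 0) \<inter> range (h 1) = {}"
    unfolding range by auto
  moreover have "F summable_on range (h j)" for j
    using F(1) by (rule summable_on_subset_banach) simp
  ultimately have "infsum F UNIV = infsum F (range (h 0)) + infsum F (range (h 1))"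
    using infsum_Un_disjoint [of F "range (h 0)" "range (h 1)"] by simp
  then show ?thesis
    using F(2) coset [of 0] coset [of 1] by simp
qed

text \<open>
  Even and odd summation indices separately: \<open>(2 n + j)\<^sup>2 \<tau> = (n + j / 2)\<^sup>2 (4 \<tau>)\<close>.
\<close>

lemma theta_split:
  assumes "Im \<tau> > 0"
  shows "theta 0 0 \<zeta> \<tau> = theta 0 0 (2 * \<zeta>) (4 * \<tau>) + theta 1 0 (2 * \<zeta>) (4 * \<tau>)"
proof -
  let ?F = "theta_term 0 \<zeta> \<tau>"
  have coset: "infsum ?F (range (\<lambda>n. 2 * n + j)) = theta (of_int j) 0 (2 * \<zeta>) (4 * \<tau>)" for j
  proof -
    have "infsum ?F (range (\<lambda>n. 2 * n + j)) = infsum (?F \<circ> (\<lambda>n. 2 * n + j)) UNIV"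
      by (rule infsum_reindex) (auto simp: inj_on_def)
    also have "?F \<circ> (\<lambda>n. 2 * n + j) = theta_term (of_int j) (2 * \<zeta>) (4 * \<tau>)"
      by (auto simp: theta_term_def fun_eq_iff field_simps power2_eq_square intro!: arg_cong [of _ _ exp])
    finally show ?thesis by (simp add: theta_eq_infsum)
  qed
  have "infsum ?F (range (\<lambda>n. 2 * n + 0) \<union> range (\<lambda>n. 2 * n + 1)) =
      infsum ?F (range (\<lambda>n. 2 * n + 0)) + infsum ?F (range (\<lambda>n. 2 * n + 1))"
    by (rule infsum_Un_disjoint)
       (auto intro!: summable_on_subset_banach [OF theta_term_summable [OF assms]], presburger)
  moreover have "range (\<lambda>n::int. 2 * n + 0) \<union> range (\<lambda>n. 2 * n + 1) = UNIV"
    by (auto simp: image_iff) presburger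
  ultimately show ?thesis
    using coset [of 0] coset [of 1] by (simp add: theta_eq_infsum)
qed

text \<open>
  In Jacobi's notation these are \<open>\<theta>\<^sub>3\<close> and \<open>\<theta>\<^sub>2\<close>, scaled so that the
  real period of \<open>\<theta>\<^sub>3\<close> is 1. The other two functions are half-period translates:
  \<open>\<theta>\<^sub>4\<close> is \<open>theta3 (\<zeta> + 1 / 2)\<close>, and \<open>theta2 (\<zeta> + 1 / 2)\<close> is
  \<open>\<theta>\<^sub>1\<close> up to sign. In particular \<open>theta3 (1 / 2) \<tau>\<close> is the constant
  \<open>\<theta>\<^sub>4\<close>, and the derivative of \<open>theta2\<close> at \<open>1 / 2\<close> is
  \<open>\<theta>\<^sub>1'\<close> up to sign.
\<close>

abbreviation (input) theta3 :: "complex \<Rightarrow> complex \<Rightarrow> complex" where "theta3 \<equiv> theta 0 0"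
abbreviation (input) theta2 :: "complex \<Rightarrow> complex \<Rightarrow> complex" where "theta2 \<equiv> theta 1 0"

lemma theta3_even: "theta3 (- \<zeta>) \<tau> = theta3 \<zeta> \<tau>"
  using theta_uminus [of 0 \<zeta> \<tau>] by simp

lemma theta2_even: "theta2 (- \<zeta>) \<tau> = theta2 \<zeta> \<tau>"
  using theta_uminus [of 1 \<zeta> \<tau>] theta_char_plus_2 [of "-1" "- \<zeta>" \<tau>] by simp

lemma theta3_plus_1: "theta3 (\<zeta> + 1) \<tau> = theta3 \<zeta> \<tau>"
  using theta_plus_1 [of 0] by simp

lemma theta2_plus_1: "theta2 (\<zeta> + 1) \<tau> = - theta2 \<zeta> \<tau>"
  using theta_plus_1 [of 1] by simp

lemma theta2_half: "theta2 (1 / 2) \<tau> = 0"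
  using theta2_plus_1 [of "- (1 / 2)" \<tau>] theta2_even [of "1 / 2" \<tau>] by simp

lemma theta3_mult:
  assumes "Im \<tau> > 0"
  shows "theta3 \<zeta> \<tau> * theta3 \<xi> \<tau> =
    theta3 (\<zeta> + \<xi>) (2 * \<tau>) * theta3 (\<zeta> - \<xi>) (2 * \<tau>) + theta2 (\<zeta> + \<xi>) (2 * \<tau>) * theta2 (\<zeta> - \<xi>) (2 * \<tau>)"
  using theta_mult [OF assms, of 0 \<zeta> 0 \<xi>] by simp

lemma theta2_mult:
  assumes "Im \<tau> > 0"
  shows "theta2 \<zeta> \<tau> * theta2 \<xi> \<tau> =
    theta2 (\<zeta> + \<xi>) (2 * \<tau>) * theta3 (\<zeta> - \<xi>) (2 * \<tau>) + theta3 (\<zeta> + \<xi>) (2 * \<tau>) * theta2 (\<zeta> - \<xi>) (2 * \<tau>)"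
  using theta_mult [OF assms, of 1 \<zeta> 1 \<xi>] theta_char_plus_2 [of 0] by simp

text \<open>
  Landen's transformation: the difference of the arguments is a half period, at which \<open>theta2\<close>
  vanishes, so one of the two products in the addition formula disappears.
\<close>

lemma theta3_mult_half_shift:
  assumes "Im \<tau> > 0"
  shows "theta3 \<zeta> \<tau> * theta3 (\<zeta> + 1 / 2) \<tau> = theta3 (2 * \<zeta> + 1 / 2) (2 * \<tau>) * theta3 (1 / 2) (2 * \<tau>)"
  using theta3_mult [OF assms, of \<zeta> "\<zeta> + 1 / 2"] theta2_even [of "1 / 2"] theta3_even [of "1 / 2"]
  by (simp add: theta2_half algebra_simps)

lemma theta2_mult_half_shift:
  assumes "Im \<tau> > 0"
  shows "theta2 \<zeta> \<tau> * theta2 (\<zeta> + 1 / 2) \<tau> = theta2 (2 * \<zeta> + 1 / 2) (2 * \<tau>) * theta3 (1 / 2) (2 * \<tau>)"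
  using theta2_mult [OF assms, of \<zeta> "\<zeta> + 1 / 2"] theta2_even [of "1 / 2"] theta3_even [of "1 / 2"]
  by (simp add: theta2_half algebra_simps)

section \<open>Behaviour under repeated doubling of the modulus\<close>

lemma Im_two_power_mult: "Im (2 ^ k * \<tau>) = 2 ^ k * Im \<tau>"
  by (induction k) (simp_all add: mult.assoc)

text \<open>
  As \<open>\<tau>\<close> tends to \<open>\<i> \<infinity>\<close>, only the terms with the smallest
  \<open>(n + \<epsilon> / 2)\<^sup>2\<close> survive once the leading power of the nome is divided out; the set
  \<open>S\<close> collects them. Their exponential in \<open>\<zeta>\<close> is the value of
  \<open>theta_term\<close> at \<open>\<tau> = 0\<close>. The convergence is uniform in \<open>\<zeta>\<close>, so that it
  passes to the derivative.
\<close>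

lemma theta_normalized_uniform_limit:
  fixes S :: "int set"
  assumes "Im \<tau> > 0" "finite S"
    and zero: "\<And>n. n \<in> S \<Longrightarrow> of_int n * (of_int n + \<epsilon>) = 0"
    and ge1: "\<And>n. n \<notin> S \<Longrightarrow> of_int n * (of_int n + \<epsilon>) \<ge> 1"
  shows "uniform_limit (cball z r)
    (\<lambda>k \<zeta>. exp (- of_real pi * \<i> * (of_real \<epsilon> / 2)\<^sup>2 * (2 ^ k * \<tau>)) * theta \<epsilon> 0 \<zeta> (2 ^ k * \<tau>))
    (\<lambda>\<zeta>. \<Sum>n\<in>S. theta_term \<epsilon> \<zeta> 0 n) sequentially"
proof -
  define R where "R = \<bar>Im z\<bar> + r"
  define G where "G = (\<lambda>n::int. exp (2 * pi * R * \<bar>of_int n + \<epsilon> / 2\<bar> - pi * Im \<tau> * (of_int n + \<epsilon> / 2)\<^sup>2))"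
  define M where "M = exp (pi * Im \<tau> * (\<epsilon> / 2)\<^sup>2) * infsum G UNIV"
  define d where "d k = exp (- (pi * Im \<tau> * (2 ^ k - 1)))" for k :: nat
  have G: "G summable_on UNIV"
    unfolding G_def using assms(1) by (intro gaussian_summable_on_int) simp
  have bound: "dist (exp (- of_real pi * \<i> * (of_real \<epsilon> / 2)\<^sup>2 * (2 ^ k * \<tau>)) * theta \<epsilon> 0 \<zeta> (2 ^ k * \<tau>))
      (\<Sum>n\<in>S. theta_term \<epsilon> \<zeta> 0 n) \<le> d k * M" if "\<zeta> \<in> cball z r" for k \<zeta>
  proof -
    let ?t = "2 ^ k * \<tau>"
    let ?c = "exp (- of_real pi * \<i> * (of_real \<epsilon> / 2)\<^sup>2 * ?t)"
    let ?g = "\<lambda>n. ?c * theta_term \<epsilon> \<zeta> ?t n - (if n \<in> S then theta_term \<epsilon> \<zeta> 0 n else 0)"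
    note Im_t = Im_two_power_mult [of k \<tau>]
    have Im\<zeta>: "\<bar>Im \<zeta>\<bar> \<le> R"
      using that abs_Im_le_cmod [of "z - \<zeta>"] by (simp add: dist_norm R_def)
    have "((\<lambda>n. if n \<in> S then theta_term \<epsilon> \<zeta> 0 n else 0) has_sum (\<Sum>n\<in>S. theta_term \<epsilon> \<zeta> 0 n)) UNIV"
      using has_sum_finite [OF \<open>finite S\<close>, of "theta_term \<epsilon> \<zeta> 0"]
      by (rule has_sum_cong_neutral [THEN iffD1, rotated -1]) auto
    moreover have "(theta_term \<epsilon> \<zeta> ?t has_sum theta \<epsilon> 0 \<zeta> ?t) UNIV"
      unfolding theta_eq_infsum using assms(1) Im_t
      by (intro has_sum_infsum theta_term_summable) simp
    ultimately have sum: "(?g has_sum (?c * theta \<epsilon> 0 \<zeta> ?t - (\<Sum>n\<in>S. theta_term \<epsilon> \<zeta> 0 n))) UNIV"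
      unfolding diff_conv_add_uminus
      by (intro has_sum_add has_sum_cmult_right has_sum_uminusI)
    have norm_c: "norm ?c = exp (pi * (2 ^ k * Im \<tau>) * (\<epsilon> / 2)\<^sup>2)"
    proof -
      have Re_scale: "Re (of_real c * w) = c * Re w" for c w
        by simp
      have "Re (- of_real pi * \<i> * (of_real \<epsilon> / 2)\<^sup>2 * ?t) = Re (of_real (- pi * (\<epsilon> / 2)\<^sup>2) * (\<i> * ?t))"
        by (rule arg_cong [of _ _ Re]) (simp add: algebra_simps)
      also have "\<dots> = pi * (2 ^ k * Im \<tau>) * (\<epsilon> / 2)\<^sup>2"
        using Re_scale [of "- pi * (\<epsilon> / 2)\<^sup>2" "\<i> * ?t"] by (simp only: Re_i_times Im_t) simp
      finally show ?thesis by (simp only: norm_exp_eq_Re)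
    qed
    \<comment> \<open>For \<open>n \<notin> S\<close> the gap of at least 1 in the normalised exponent yields the
      factor \<open>d k\<close> beyond the decay that is already present at \<open>\<tau>\<close> itself.\<close>
    have term_le: "norm (?g n) \<le> d k * (exp (pi * Im \<tau> * (\<epsilon> / 2)\<^sup>2) * G n)" for n
    proof (cases "n \<in> S")
      case True
      have "(of_int n + \<epsilon> / 2)\<^sup>2 = of_int n * (of_int n + \<epsilon>) + (\<epsilon> / 2)\<^sup>2"
        by (simp add: power2_eq_square field_simps)
      then have "(of_int n + \<epsilon> / 2)\<^sup>2 = (\<epsilon> / 2)\<^sup>2"
        unfolding zero [OF True] by simp
      then have "complex_of_real ((of_int n + \<epsilon> / 2)\<^sup>2) = of_real ((\<epsilon> / 2)\<^sup>2)"
        by (simp only:)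
      then have "(of_int n + of_real \<epsilon> / 2)\<^sup>2 = (of_real \<epsilon> / 2 :: complex)\<^sup>2"
        by simp
      then have "?c * theta_term \<epsilon> \<zeta> ?t n = theta_term \<epsilon> \<zeta> 0 n"
        unfolding theta_term_def exp_add [symmetric]
        by (intro arg_cong [of _ _ exp]) (simp add: algebra_simps)
      then show ?thesis
        using True by (simp add: d_def G_def)
    next
      case False
      define s where "s = of_int n + \<epsilon> / 2"
      have "s\<^sup>2 - (\<epsilon> / 2)\<^sup>2 \<ge> 1"
        using ge1 [OF False] by (simp add: s_def power2_eq_square algebra_simps)
      then have "pi * Im \<tau> * (2 ^ k - 1) * 1 \<le> pi * Im \<tau> * (2 ^ k - 1) * (s\<^sup>2 - (\<epsilon> / 2)\<^sup>2)"
        using assms(1) by (intro mult_left_mono) auto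
      then have exponent: "pi * (2 ^ k * Im \<tau>) * (\<epsilon> / 2)\<^sup>2 + (2 * pi * R * \<bar>s\<bar> - pi * (2 ^ k * Im \<tau>) * s\<^sup>2)
          \<le> - (pi * Im \<tau> * (2 ^ k - 1)) + (pi * Im \<tau> * (\<epsilon> / 2)\<^sup>2 + (2 * pi * R * \<bar>s\<bar> - pi * Im \<tau> * s\<^sup>2))"
        by (simp add: algebra_simps)
      have "norm (?g n) = norm ?c * norm (theta_term \<epsilon> \<zeta> ?t n)"
        using False by (simp add: norm_mult)
      also have "\<dots> \<le> exp (pi * (2 ^ k * Im \<tau>) * (\<epsilon> / 2)\<^sup>2) * exp (2 * pi * R * \<bar>s\<bar> - pi * (2 ^ k * Im \<tau>) * s\<^sup>2)"
        unfolding norm_c using norm_theta_term_le [OF Im\<zeta>, of \<epsilon> ?t n] unfolding Im_t s_def [symmetric]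
        by (intro mult_left_mono) auto
      also have "\<dots> \<le> d k * (exp (pi * Im \<tau> * (\<epsilon> / 2)\<^sup>2) * G n)"
        using exponent unfolding d_def G_def s_def [symmetric] exp_add [symmetric] by simp
      finally show ?thesis .
    qed
    have "((\<lambda>n. d k * (exp (pi * Im \<tau> * (\<epsilon> / 2)\<^sup>2) * G n)) has_sum (d k * M)) UNIV"
      unfolding M_def using G by (intro has_sum_cmult_right has_sum_infsum)
    then show ?thesis
      unfolding dist_norm using term_le by (rule norm_infsum_le [OF sum])
  qed
  have "(\<lambda>k. d k * M) \<longlonglongrightarrow> 0 * M"
    unfolding d_def using assms(1) by (intro tendsto_intros) real_asymp
  then have lim: "\<forall>\<^sub>F k in sequentially. d k * M < e" if "e > 0" for e
    using that order_tendstoD(2) by fastforce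
  show ?thesis
  proof (rule uniform_limitI)
    fix e :: real assume "e > 0"
    show "\<forall>\<^sub>F k in sequentially. \<forall>\<zeta>\<in>cball z r.
      dist (exp (- of_real pi * \<i> * (of_real \<epsilon> / 2)\<^sup>2 * (2 ^ k * \<tau>)) * theta \<epsilon> 0 \<zeta> (2 ^ k * \<tau>))
        (\<Sum>n\<in>S. theta_term \<epsilon> \<zeta> 0 n) < e"
      using lim [OF \<open>e > 0\<close>] by (rule eventually_mono) (meson bound le_less_trans)
  qed
qed

lemma theta3_tendsto_1:
  assumes "Im \<tau> > 0"
  shows "(\<lambda>k. theta3 \<zeta> (2 ^ k * \<tau>)) \<longlonglongrightarrow> 1"
proof -
  have ge1: "of_int n * (of_int n + 0) \<ge> (1::real)" if "n \<notin> {0}" for n :: int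
  proof -
    have "n * n \<ge> 1" using that by (simp add: int_one_le_iff_zero_less zero_less_mult_iff) linarith
    then show ?thesis by (metis add.right_neutral of_int_1_le_iff of_int_mult)
  qed
  have "uniform_limit (cball \<zeta> 0) (\<lambda>k \<zeta>. theta3 \<zeta> (2 ^ k * \<tau>)) (\<lambda>\<zeta>. 1) sequentially"
    using theta_normalized_uniform_limit [OF assms, of "{0}" 0 \<zeta> 0] ge1
    by (simp add: theta_term_def)
  then show ?thesis
    by (rule tendsto_uniform_limitI) simp
qed

lemma theta2_normalized_uniform_limit:
  assumes "Im \<tau> > 0"
  shows "uniform_limit (cball z r)
    (\<lambda>k \<zeta>. exp (- of_real pi * \<i> / 4 * (2 ^ k * \<tau>)) * theta2 \<zeta> (2 ^ k * \<tau>))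
    (\<lambda>\<zeta>. 2 * cos (of_real pi * \<zeta>)) sequentially"
proof -
  have ge1: "of_int n * (of_int n + 1) \<ge> (1::real)" if "n \<notin> {0, -1}" for n :: int
  proof -
    have "n * (n + 1) > 0" using that by (simp add: zero_less_mult_iff) linarith
    then have "1 \<le> n * (n + 1)" by simp
    then show ?thesis by (metis of_int_1 of_int_1_le_iff of_int_add of_int_mult)
  qed
  have limit: "(\<Sum>n\<in>{0,-1}. theta_term 1 \<zeta> 0 n) = 2 * cos (of_real pi * \<zeta>)" for \<zeta>
    by (simp add: theta_term_def cos_exp_eq algebra_simps)
  have exponent: "- of_real pi * \<i> * (of_real 1 / 2)\<^sup>2 * (2 ^ k * \<tau>) = - of_real pi * \<i> / 4 * (2 ^ k * \<tau>)"
    for k :: nat by (simp add: power2_eq_square)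
  have "of_int n * (of_int n + 1) = (0::real)" if "n \<in> {0, -1}" for n :: int
    using that by auto
  then show ?thesis
    using theta_normalized_uniform_limit [OF assms, of "{0,-1}" 1 z r] ge1
    unfolding limit exponent by simp
qed

lemma theta2_normalized_tendsto:
  assumes "Im \<tau> > 0"
  shows "(\<lambda>k. exp (- of_real pi * \<i> / 4 * (2 ^ k * \<tau>)) * theta2 \<zeta> (2 ^ k * \<tau>))
    \<longlonglongrightarrow> 2 * cos (of_real pi * \<zeta>)"
  using theta2_normalized_uniform_limit [OF assms, of \<zeta> 0] by (rule tendsto_uniform_limitI) simp

text \<open>
  Locally uniform limits of holomorphic functions may be differentiated.
\<close>

lemma theta2_deriv_normalized_tendsto:
  assumes "Im \<tau> > 0"
  shows "(\<lambda>k. exp (- of_real pi * \<i> / 4 * (2 ^ k * \<tau>)) * theta_deriv 1 0 \<zeta> (2 ^ k * \<tau>))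
    \<longlonglongrightarrow> - 2 * of_real pi * sin (of_real pi * \<zeta>)"
proof -
  let ?f = "\<lambda>k \<zeta>. exp (- of_real pi * \<i> / 4 * (2 ^ k * \<tau>)) * theta2 \<zeta> (2 ^ k * \<tau>)"
  let ?f' = "\<lambda>k \<zeta>. exp (- of_real pi * \<i> / 4 * (2 ^ k * \<tau>)) * theta_deriv 1 0 \<zeta> (2 ^ k * \<tau>)"
  have Im: "Im (2 ^ k * \<tau>) > 0" for k :: nat
    using assms by (simp add: Im_two_power_mult)
  have der: "(?f k has_field_derivative ?f' k w) (at w)" for k w
    using Im by (auto intro!: derivative_eq_intros)
  have "continuous_on (cball \<zeta> 1) (?f k)" for k
    by (intro continuous_at_imp_continuous_on ballI DERIV_isCont [OF der])
  with der have ev: "\<forall>\<^sub>F k in sequentially. continuous_on (cball \<zeta> 1) (?f k) \<and>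
      (\<forall>w\<in>ball \<zeta> 1. (?f k has_field_derivative ?f' k w) (at w))"
    by (simp add: always_eventually)
  obtain g' where g': "\<And>w. w \<in> ball \<zeta> 1 \<Longrightarrow>
      ((\<lambda>\<zeta>. 2 * cos (of_real pi * \<zeta>)) has_field_derivative g' w) (at w) \<and> (\<lambda>k. ?f' k w) \<longlonglongrightarrow> g' w"
    by (rule has_complex_derivative_uniform_limit
      [OF ev theta2_normalized_uniform_limit [OF assms] sequentially_bot zero_less_one]) blast
  have "((\<lambda>\<zeta>. 2 * cos (of_real pi * \<zeta>)) has_field_derivative - 2 * of_real pi * sin (of_real pi * \<zeta>)) (at \<zeta>)"
    by (auto intro!: derivative_eq_intros)
  then have "g' \<zeta> = - 2 * of_real pi * sin (of_real pi * \<zeta>)"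
    using g' [of \<zeta>] DERIV_unique by (metis centre_in_ball zero_less_one)
  then show ?thesis
    using g' [of \<zeta>] by simp
qed

text \<open>
  The tool that turns a duplication formula into an exact evaluation: invariance under
  \<open>\<tau> \<mapsto> 2 \<tau>\<close> makes the sequence constant, so its limit at \<open>\<i> \<infinity>\<close> is its value.
\<close>

lemma doubling_invariant_eq_limit:
  fixes f :: "complex \<Rightarrow> complex"
  assumes "Im \<tau> > 0" "\<And>\<tau>. Im \<tau> > 0 \<Longrightarrow> f (2 * \<tau>) = f \<tau>" "(\<lambda>k. f (2 ^ k * \<tau>)) \<longlonglongrightarrow> L"
  shows "f \<tau> = L"
proof -
  have "Im (2 ^ k * \<tau>) > 0 \<and> f (2 ^ k * \<tau>) = f \<tau>" for k :: nat
    by (induction k) (use assms(1,2) in \<open>auto simp: mult.assoc\<close>)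
  then show ?thesis
    using assms(3) by (simp add: LIMSEQ_const_iff)
qed

lemma doubling_descent:
  fixes P :: "complex \<Rightarrow> bool"
  assumes "Im \<tau> > 0" "\<And>\<tau>. Im \<tau> > 0 \<Longrightarrow> P (2 * \<tau>) \<Longrightarrow> P \<tau>" "\<forall>\<^sub>F k in sequentially. P (2 ^ k * \<tau>)"
  shows "P \<tau>"
proof -
  have "Im \<tau> > 0 \<Longrightarrow> P (2 ^ k * \<tau>) \<Longrightarrow> P \<tau>" for k :: nat and \<tau>
  proof (induction k arbitrary: \<tau>)
    case (Suc k)
    have "P (2 ^ k * (2 * \<tau>))"
      using Suc.prems(2) by (simp add: mult_ac)
    then have "P (2 * \<tau>)"
      using Suc.IH [of "2 * \<tau>"] Suc.prems(1) by simp
    then show ?case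
      using assms(2) Suc.prems(1) by blast
  qed simp
  then show ?thesis
    using assms(1,3) eventually_sequentially by (metis order_refl)
qed

section \<open>Theta constants and the derivative formula of Jacobi\<close>

lemma theta4_squared:
  assumes "Im \<tau> > 0"
  shows "theta3 0 \<tau> * theta3 (1 / 2) \<tau> = (theta3 (1 / 2) (2 * \<tau>))\<^sup>2"
  using theta3_mult_half_shift [OF assms, of 0] by (simp add: power2_eq_square)

lemma theta2_squared:
  assumes "Im \<tau> > 0"
  shows "(theta2 0 \<tau>)\<^sup>2 = 2 * theta2 0 (2 * \<tau>) * theta3 0 (2 * \<tau>)"
  using theta2_mult [OF assms, of 0 0] by (simp add: power2_eq_square)

text \<open>
  The constants are nonzero near \<open>\<i> \<infinity>\<close>, and the duplication formulas for
  \<open>\<theta>\<^sub>3 \<theta>\<^sub>4\<close> and \<open>\<theta>\<^sub>2\<^sup>2\<close> carry this back from \<open>2 \<tau>\<close> to \<open>\<tau>\<close>.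
\<close>

lemma theta_constants_nonzero:
  assumes "Im \<tau> > 0"
  shows "theta2 0 \<tau> \<noteq> 0" "theta3 0 \<tau> \<noteq> 0" "theta3 (1 / 2) \<tau> \<noteq> 0"
proof -
  let ?P = "\<lambda>\<tau>. theta2 0 \<tau> \<noteq> 0 \<and> theta3 0 \<tau> \<noteq> 0 \<and> theta3 (1 / 2) \<tau> \<noteq> 0"
  have "?P \<tau>"
    using assms
  proof (rule doubling_descent)
    show "?P \<tau>" if "Im \<tau> > 0" "?P (2 * \<tau>)" for \<tau>
      using theta4_squared [OF that(1)] theta2_squared [OF that(1)] that(2) by auto
    have "\<forall>\<^sub>F k in sequentially. theta3 \<zeta> (2 ^ k * \<tau>) \<noteq> 0" for \<zeta>
      using theta3_tendsto_1 [OF assms] by (rule tendsto_imp_eventually_ne) simp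
    moreover have "\<forall>\<^sub>F k in sequentially. theta2 0 (2 ^ k * \<tau>) \<noteq> 0"
      using tendsto_imp_eventually_ne [OF theta2_normalized_tendsto [OF assms, of 0], of 0]
      by simp
    ultimately show "\<forall>\<^sub>F k in sequentially. ?P (2 ^ k * \<tau>)"
      by (simp add: eventually_conj_iff)
  qed
  then show "theta2 0 \<tau> \<noteq> 0" "theta3 0 \<tau> \<noteq> 0" "theta3 (1 / 2) \<tau> \<noteq> 0"
    by blast+
qed

lemma theta3_deriv_plus_1:
  assumes "Im \<tau> > 0"
  shows "theta_deriv 0 0 (\<zeta> + 1) \<tau> = theta_deriv 0 0 \<zeta> \<tau>"
proof -
  have "((\<lambda>z. theta3 (z + 1) \<tau>) has_field_derivative theta_deriv 0 0 (\<zeta> + 1) \<tau> * 1) (at \<zeta>)"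
    using assms by (auto intro!: derivative_eq_intros)
  moreover have "((\<lambda>z. theta3 z \<tau>) has_field_derivative theta_deriv 0 0 \<zeta> \<tau> * 1) (at \<zeta>)"
    using assms by (auto intro!: derivative_eq_intros)
  ultimately show ?thesis
    unfolding theta3_plus_1 using DERIV_unique by fastforce
qed

lemma theta3_deriv_odd:
  assumes "Im \<tau> > 0"
  shows "theta_deriv 0 0 (- \<zeta>) \<tau> = - theta_deriv 0 0 \<zeta> \<tau>"
proof -
  have "((\<lambda>z. theta3 (- z) \<tau>) has_field_derivative theta_deriv 0 0 (- \<zeta>) \<tau> * - 1) (at \<zeta>)"
    using assms by (auto intro!: derivative_eq_intros)
  moreover have "((\<lambda>z. theta3 z \<tau>) has_field_derivative theta_deriv 0 0 \<zeta> \<tau> * 1) (at \<zeta>)"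
    using assms by (auto intro!: derivative_eq_intros)
  ultimately show ?thesis
    unfolding theta3_even using DERIV_unique by fastforce
qed

lemma theta3_deriv_half:
  assumes "Im \<tau> > 0"
  shows "theta_deriv 0 0 (1 / 2) \<tau> = 0"
  using theta3_deriv_plus_1 [OF assms, of "- (1 / 2)"] theta3_deriv_odd [OF assms, of "1 / 2"]
  by simp

lemma theta2_deriv_doubling:
  assumes "Im \<tau> > 0"
  shows "theta2 0 \<tau> * theta_deriv 1 0 (1 / 2) \<tau> =
    2 * theta_deriv 1 0 (1 / 2) (2 * \<tau>) * theta3 (1 / 2) (2 * \<tau>)"
proof -
  have "((\<lambda>\<zeta>. theta2 \<zeta> \<tau> * theta2 (\<zeta> + 1 / 2) \<tau>) has_field_derivative
      theta2 0 \<tau> * theta_deriv 1 0 (1 / 2) \<tau>) (at 0)"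
    using assms by (auto intro!: derivative_eq_intros simp: theta2_half)
  moreover have "((\<lambda>\<zeta>. theta2 (2 * \<zeta> + 1 / 2) (2 * \<tau>) * theta3 (1 / 2) (2 * \<tau>)) has_field_derivative
      2 * theta_deriv 1 0 (1 / 2) (2 * \<tau>) * theta3 (1 / 2) (2 * \<tau>)) (at 0)"
    using assms by (auto intro!: derivative_eq_intros)
  ultimately show ?thesis
    unfolding theta2_mult_half_shift [OF assms] by (rule DERIV_unique)
qed

text \<open>
  Jacobi's formula \<open>\<theta>\<^sub>1' = \<pi> \<theta>\<^sub>2 \<theta>\<^sub>3 \<theta>\<^sub>4\<close>. By
  Landen's transformation both sides are multiplied by the same factor
  \<open>\<theta>\<^sub>2(\<tau>) / (2 \<theta>\<^sub>4(2 \<tau>))\<close> when \<open>\<tau>\<close> is doubled. Their quotient is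
  therefore invariant under doubling, and the leading terms at \<open>\<i> \<infinity>\<close> determine it.
\<close>

theorem jacobi_derivative_formula:
  assumes "Im \<tau> > 0"
  shows "theta_deriv 1 0 (1 / 2) \<tau> = - of_real pi * theta2 0 \<tau> * theta3 0 \<tau> * theta3 (1 / 2) \<tau>"
proof -
  let ?J = "\<lambda>\<tau>. theta_deriv 1 0 (1 / 2) \<tau> / (theta2 0 \<tau> * theta3 0 \<tau> * theta3 (1 / 2) \<tau>)"
  have "?J \<tau> = - of_real pi"
    using assms
  proof (rule doubling_invariant_eq_limit)
    fix \<tau> assume \<tau>: "Im \<tau> > 0"
    then have \<tau>2: "Im (2 * \<tau>) > 0" by simp
    note nz = theta_constants_nonzero [OF \<tau>] theta_constants_nonzero [OF \<tau>2]
    have "theta_deriv 1 0 (1 / 2) (2 * \<tau>) * (theta2 0 \<tau> * theta3 0 \<tau> * theta3 (1 / 2) \<tau>) * 2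
        = theta_deriv 1 0 (1 / 2) \<tau> * (theta2 0 (2 * \<tau>) * theta3 0 (2 * \<tau>) * theta3 (1 / 2) (2 * \<tau>)) * 2"
      using theta2_deriv_doubling [OF \<tau>] theta4_squared [OF \<tau>] theta2_squared [OF \<tau>] by algebra
    then show "?J (2 * \<tau>) = ?J \<tau>"
      using nz by (simp add: frac_eq_eq)
  next
    let ?q = "\<lambda>k. exp (- of_real pi * \<i> / 4 * (2 ^ k * \<tau>))"
    have "(\<lambda>k. ?q k * theta_deriv 1 0 (1 / 2) (2 ^ k * \<tau>) /
          (?q k * theta2 0 (2 ^ k * \<tau>) * theta3 0 (2 ^ k * \<tau>) * theta3 (1 / 2) (2 ^ k * \<tau>)))
        \<longlonglongrightarrow> - 2 * of_real pi * sin (of_real pi * (1 / 2)) / (2 * cos (of_real pi * 0) * 1 * 1)"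
      by (intro tendsto_divide tendsto_mult theta2_deriv_normalized_tendsto theta2_normalized_tendsto
          theta3_tendsto_1 assms) simp
    moreover have "sin (of_real pi * (1 / 2)) = (1 :: complex)"
      using sin_of_real [of "pi / 2", where 'a = complex] by simp
    ultimately show "(\<lambda>k. ?J (2 ^ k * \<tau>)) \<longlonglongrightarrow> - of_real pi"
      by (simp add: mult.assoc)
  qed
  then show ?thesis
    using theta_constants_nonzero [OF assms] by (simp add: field_simps)
qed

section \<open>Division points of order four and eight\<close>

lemma theta3_quarter:
  assumes "Im \<tau> > 0"
  shows "theta3 (1 / 4) \<tau> = theta3 (1 / 2) (4 * \<tau>)"
  using theta_split [OF assms, of "1 / 4"] by (simp add: theta2_half)

text \<open>
  The quadratic forms of the two sides, a sum of two squares and a form of discriminant \<open>-8\<close>,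
  are not related by a substitution in the double series. The
  quotient is nevertheless invariant under doubling, which leaves a comparison of leading terms;
  the factor \<open>sqrt 2\<close> is \<open>2 cos (\<pi> / 4)\<close>.
\<close>

lemma theta2_mult_quarter:
  assumes "Im \<tau> > 0"
  shows "theta2 0 \<tau> * theta2 (1 / 4) \<tau> = of_real (sqrt 2) * theta2 0 (2 * \<tau>) * theta3 (1 / 2) (4 * \<tau>)"
proof -
  let ?r = "\<lambda>\<tau>. theta2 0 \<tau> * theta2 (1 / 4) \<tau> / (theta2 0 (2 * \<tau>) * theta3 (1 / 2) (4 * \<tau>))"
  have "?r \<tau> = of_real (sqrt 2)"
    using assms
  proof (rule doubling_invariant_eq_limit)
    fix \<tau> assume \<tau>: "Im \<tau> > 0"
    then have Im: "Im (2 * \<tau>) > 0" "Im (4 * \<tau>) > 0" "Im (8 * \<tau>) > 0" by simp_all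
    note nz = theta_constants_nonzero [OF \<tau>] theta_constants_nonzero [OF Im(1)]
      theta_constants_nonzero [OF Im(2)] theta_constants_nonzero [OF Im(3)]
    have "theta2 0 \<tau> * theta2 (1 / 4) \<tau> = 2 * theta2 (1 / 4) (2 * \<tau>) * theta3 (1 / 2) (8 * \<tau>)"
      using theta2_mult [OF \<tau>, of "1 / 4" 0] theta3_quarter [OF Im(1)] by (simp add: mult_ac)
    moreover have "(theta2 0 (2 * \<tau>))\<^sup>2 = 2 * theta2 0 (4 * \<tau>) * theta3 0 (4 * \<tau>)"
      using theta2_squared [OF Im(1)] by simp
    moreover have "theta3 0 (4 * \<tau>) * theta3 (1 / 2) (4 * \<tau>) = (theta3 (1 / 2) (8 * \<tau>))\<^sup>2"
      using theta4_squared [OF Im(2)] by simp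
    ultimately have "theta2 0 (2 * \<tau>) * theta2 (1 / 4) (2 * \<tau>) * (theta2 0 (2 * \<tau>) * theta3 (1 / 2) (4 * \<tau>)) =
        theta2 0 \<tau> * theta2 (1 / 4) \<tau> * (theta2 0 (4 * \<tau>) * theta3 (1 / 2) (8 * \<tau>))"
      by algebra
    then show "?r (2 * \<tau>) = ?r \<tau>"
      using nz by (simp add: frac_eq_eq)
  next
    let ?q = "\<lambda>k. exp (- of_real pi * \<i> / 4 * (2 ^ k * \<tau>))"
    have Im: "Im (2 * \<tau>) > 0" "Im (4 * \<tau>) > 0" using assms by simp_all
    have shift: "2 ^ k * (c * \<tau>) = c * (2 ^ k * \<tau>)" for k :: nat and c
      by (simp add: mult_ac)
    have q2: "exp (- of_real pi * \<i> / 4 * (2 * (2 ^ k * \<tau>))) = ?q k * ?q k" for k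
      by (simp flip: exp_add)
    have cancel: "(q * a) * (q * b) / (q * q * c * d) = a * b / (c * d)" if "q \<noteq> 0" for q a b c d :: complex
    proof -
      have "(q * a) * (q * b) / (q * q * c * d) = (q * q) * (a * b) / ((q * q) * (c * d))"
        by (simp only: mult_ac)
      then show ?thesis using that by simp
    qed
    have "(\<lambda>k. (?q k * theta2 0 (2 ^ k * \<tau>)) * (?q k * theta2 (1 / 4) (2 ^ k * \<tau>)) /
          (exp (- of_real pi * \<i> / 4 * (2 ^ k * (2 * \<tau>))) * theta2 0 (2 ^ k * (2 * \<tau>)) * theta3 (1 / 2) (2 ^ k * (4 * \<tau>))))
        \<longlonglongrightarrow> (2 * cos (of_real pi * 0)) * (2 * cos (of_real pi * (1 / 4))) / (2 * cos (of_real pi * 0) * 1)"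
      by (intro tendsto_divide tendsto_mult theta2_normalized_tendsto theta3_tendsto_1 assms Im) simp
    also have "(2 * cos (of_real pi * 0)) * (2 * cos (of_real pi * (1 / 4))) / (2 * cos (of_real pi * 0) * 1)
        = complex_of_real (sqrt 2)"
      using cos_of_real [of "pi / 4", where 'a = complex] by (simp add: cos_45 mult.commute)
    finally show "(\<lambda>k. ?r (2 ^ k * \<tau>)) \<longlonglongrightarrow> of_real (sqrt 2)"
      unfolding shift q2 cancel [OF exp_not_eq_zero] .
  qed
  then show ?thesis
    using assms theta_constants_nonzero [of "2 * \<tau>"] theta_constants_nonzero [of "4 * \<tau>"]
    by (simp add: field_simps)
qed

text \<open>
  At \<open>2 \<zeta> = 1 / 2\<close> the two pieces of the splitting are a critical point of
  \<open>theta3\<close> and a zero of \<open>theta2\<close>. Only \<open>\<theta>\<^sub>1'\<close> at \<open>4 \<tau>\<close>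
  remains, and Jacobi's formula evaluates it.
\<close>

lemma theta3_deriv_quarter:
  assumes "Im \<tau> > 0"
  shows "theta_deriv 0 0 (1 / 4) \<tau> = - of_real pi * (theta2 0 (2 * \<tau>))\<^sup>2 * theta3 (1 / 4) \<tau>"
proof -
  have Im: "Im (2 * \<tau>) > 0" "Im (4 * \<tau>) > 0" using assms by simp_all
  have "((\<lambda>\<zeta>. theta3 (2 * \<zeta>) (4 * \<tau>) + theta2 (2 * \<zeta>) (4 * \<tau>)) has_field_derivative
      2 * theta_deriv 1 0 (1 / 2) (4 * \<tau>)) (at (1 / 4))"
    using Im by (auto intro!: derivative_eq_intros simp: theta3_deriv_half)
  moreover have "((\<lambda>\<zeta>. theta3 \<zeta> \<tau>) has_field_derivative theta_deriv 0 0 (1 / 4) \<tau> * 1) (at (1 / 4))"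
    using assms by (auto intro!: derivative_eq_intros)
  ultimately have "theta_deriv 0 0 (1 / 4) \<tau> = 2 * theta_deriv 1 0 (1 / 2) (4 * \<tau>)"
    unfolding theta_split [OF assms] using DERIV_unique by fastforce
  then show ?thesis
    using jacobi_derivative_formula [OF Im(2)] theta2_squared [OF Im(1)] theta3_quarter [OF assms]
    by simp
qed

lemma theta3_eighths_mult:
  assumes "Im \<tau> > 0"
  shows "theta3 (1 / 8) \<tau> * theta3 (3 / 8) \<tau> = theta3 (1 / 4) (2 * \<tau>) * theta3 (1 / 2) (2 * \<tau>)"
proof -
  have "theta3 (5 / 8) \<tau> = theta3 (3 / 8) \<tau>" "theta3 (3 / 4) (2 * \<tau>) = theta3 (1 / 4) (2 * \<tau>)"
    using theta3_plus_1 [of "- (3 / 8)"] theta3_even [of "3 / 8"]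
      theta3_plus_1 [of "- (1 / 4)"] theta3_even [of "1 / 4"] by simp_all
  then show ?thesis
    using theta3_mult_half_shift [OF assms, of "1 / 8"] by simp
qed

text \<open>
  The difference of the logarithmic derivatives at \<open>1 / 8\<close> and \<open>3 / 8\<close>. Since
  \<open>theta3\<close> is even with period 1, the point \<open>5 / 8 = 1 / 8 + 1 / 2\<close> is \<open>3 / 8\<close>
  reflected, and the derivative changes sign there. Differentiating Landen's transformation at
  \<open>1 / 8\<close> thus produces a Wronskian, and the right-hand side is a derivative at the point
  \<open>3 / 4\<close>, that is, at \<open>1 / 4\<close> up to sign.
\<close>

lemma theta3_eighths_wronskian:
  assumes "Im \<tau> > 0"
  shows "theta_deriv 0 0 (1 / 8) \<tau> * theta3 (3 / 8) \<tau> - theta3 (1 / 8) \<tau> * theta_deriv 0 0 (3 / 8) \<tau> =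
    2 * of_real pi * (theta2 0 (4 * \<tau>))\<^sup>2 * (theta3 (1 / 8) \<tau> * theta3 (3 / 8) \<tau>)"
proof -
  have Im: "Im (2 * \<tau>) > 0" using assms by simp
  have "((\<lambda>\<zeta>. theta3 \<zeta> \<tau> * theta3 (\<zeta> + 1 / 2) \<tau>) has_field_derivative
      theta_deriv 0 0 (1 / 8) \<tau> * theta3 (5 / 8) \<tau> + theta3 (1 / 8) \<tau> * theta_deriv 0 0 (5 / 8) \<tau>) (at (1 / 8))"
    using assms by (auto intro!: derivative_eq_intros)
  moreover have "((\<lambda>\<zeta>. theta3 (2 * \<zeta> + 1 / 2) (2 * \<tau>) * theta3 (1 / 2) (2 * \<tau>)) has_field_derivative
      2 * theta_deriv 0 0 (3 / 4) (2 * \<tau>) * theta3 (1 / 2) (2 * \<tau>)) (at (1 / 8))"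
    using assms by (auto intro!: derivative_eq_intros)
  ultimately have "theta_deriv 0 0 (1 / 8) \<tau> * theta3 (5 / 8) \<tau> + theta3 (1 / 8) \<tau> * theta_deriv 0 0 (5 / 8) \<tau>
      = 2 * theta_deriv 0 0 (3 / 4) (2 * \<tau>) * theta3 (1 / 2) (2 * \<tau>)"
    unfolding theta3_mult_half_shift [OF assms] by (rule DERIV_unique)
  moreover have "theta3 (5 / 8) \<tau> = theta3 (3 / 8) \<tau>"
    using theta3_plus_1 [of "- (3 / 8)"] theta3_even [of "3 / 8"] by simp
  moreover have "theta_deriv 0 0 (5 / 8) \<tau> = - theta_deriv 0 0 (3 / 8) \<tau>"
    using theta3_deriv_plus_1 [OF assms, of "- (3 / 8)"] theta3_deriv_odd [OF assms, of "3 / 8"] by simp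
  moreover have "theta_deriv 0 0 (3 / 4) (2 * \<tau>) = - theta_deriv 0 0 (1 / 4) (2 * \<tau>)"
    using theta3_deriv_plus_1 [OF Im, of "- (1 / 4)"] theta3_deriv_odd [OF Im, of "1 / 4"] by simp
  ultimately show ?thesis
    using theta3_deriv_quarter [OF Im] theta3_eighths_mult [OF assms] by simp
qed

text \<open>
  The sum of the logarithmic derivatives at \<open>1 / 8\<close> and \<open>3 / 8\<close>. When both arguments
  move in the same direction, their difference stays fixed and their sum passes through
  \<open>1 / 2\<close>, where \<open>theta3\<close> is stationary; the derivative of the product is a multiple
  of \<open>\<theta>\<^sub>1'\<close> at \<open>2 \<tau>\<close>.
\<close>

lemma theta3_eighths_product_deriv:
  assumes "Im \<tau> > 0"
  shows "theta_deriv 0 0 (1 / 8) \<tau> * theta3 (3 / 8) \<tau> + theta3 (1 / 8) \<tau> * theta_deriv 0 0 (3 / 8) \<tau> =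
    - 2 * of_real pi * of_real (sqrt 2) * theta2 0 (4 * \<tau>) * theta3 0 (2 * \<tau>) * (theta3 (1 / 8) \<tau> * theta3 (3 / 8) \<tau>)"
proof -
  have Im: "Im (2 * \<tau>) > 0" using assms by simp
  have eq: "theta3 (1 / 8 + u) \<tau> * theta3 (3 / 8 + u) \<tau> =
      theta3 (1 / 2 + 2 * u) (2 * \<tau>) * theta3 (1 / 4) (2 * \<tau>) + theta2 (1 / 2 + 2 * u) (2 * \<tau>) * theta2 (1 / 4) (2 * \<tau>)"
    for u
    using theta3_mult [OF assms, of "1 / 8 + u" "3 / 8 + u"] theta3_even [of "1 / 4"] theta2_even [of "1 / 4"]
    by (simp add: algebra_simps)
  have "((\<lambda>u. theta3 (1 / 8 + u) \<tau> * theta3 (3 / 8 + u) \<tau>) has_field_derivative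
      theta_deriv 0 0 (1 / 8) \<tau> * theta3 (3 / 8) \<tau> + theta3 (1 / 8) \<tau> * theta_deriv 0 0 (3 / 8) \<tau>) (at 0)"
    using assms by (auto intro!: derivative_eq_intros)
  moreover have "((\<lambda>u. theta3 (1 / 2 + 2 * u) (2 * \<tau>) * theta3 (1 / 4) (2 * \<tau>) +
        theta2 (1 / 2 + 2 * u) (2 * \<tau>) * theta2 (1 / 4) (2 * \<tau>)) has_field_derivative
      2 * theta_deriv 1 0 (1 / 2) (2 * \<tau>) * theta2 (1 / 4) (2 * \<tau>)) (at 0)"
    using assms by (auto intro!: derivative_eq_intros simp: theta3_deriv_half)
  ultimately have "theta_deriv 0 0 (1 / 8) \<tau> * theta3 (3 / 8) \<tau> + theta3 (1 / 8) \<tau> * theta_deriv 0 0 (3 / 8) \<tau>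
      = 2 * theta_deriv 1 0 (1 / 2) (2 * \<tau>) * theta2 (1 / 4) (2 * \<tau>)"
    unfolding eq by (rule DERIV_unique)
  also have "\<dots> = - 2 * of_real pi * theta3 0 (2 * \<tau>) * theta3 (1 / 2) (2 * \<tau>) * (theta2 0 (2 * \<tau>) * theta2 (1 / 4) (2 * \<tau>))"
    using jacobi_derivative_formula [OF Im] by simp
  also have "theta2 0 (2 * \<tau>) * theta2 (1 / 4) (2 * \<tau>) =
      of_real (sqrt 2) * theta2 0 (4 * \<tau>) * theta3 (1 / 4) (2 * \<tau>)"
    using theta2_mult_quarter [OF Im] theta3_quarter [OF Im] by simp
  finally show ?thesis
    unfolding theta3_eighths_mult [OF assms] by (simp add: mult_ac)
qed

theorem theorem7p7:
  fixes \<tau> :: complex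
  assumes "Im \<tau> > 0"
  shows "theta_deriv 0 (1 / 4) 0 \<tau> =
           - of_real pi * theta 0 (1 / 4) 0 \<tau> * theta 1 0 0 (4 * \<tau>) *
             (of_real (sqrt 2) * theta 0 0 0 (2 * \<tau>) - theta 1 0 0 (4 * \<tau>))
         \<and> theta_deriv 0 (3 / 4) 0 \<tau> =
           - of_real pi * theta 0 (3 / 4) 0 \<tau> * theta 1 0 0 (4 * \<tau>) *
             (of_real (sqrt 2) * theta 0 0 0 (2 * \<tau>) + theta 1 0 0 (4 * \<tau>))"
proof -
  have shift: "theta 0 (1 / 4) 0 \<tau> = theta3 (1 / 8) \<tau>" "theta 0 (3 / 4) 0 \<tau> = theta3 (3 / 8) \<tau>"
    "theta_deriv 0 (1 / 4) 0 \<tau> = theta_deriv 0 0 (1 / 8) \<tau>"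
    "theta_deriv 0 (3 / 4) 0 \<tau> = theta_deriv 0 0 (3 / 8) \<tau>"
    using theta_characteristic_shift [of 0 "1 / 4" 0 \<tau>] theta_characteristic_shift [of 0 "3 / 4" 0 \<tau>]
      theta_deriv_characteristic_shift [OF assms, of 0 "1 / 4" 0]
      theta_deriv_characteristic_shift [OF assms, of 0 "3 / 4" 0]
    by simp_all
  have "theta3 (1 / 8) \<tau> * theta3 (3 / 8) \<tau> \<noteq> 0"
    unfolding theta3_eighths_mult [OF assms]
    using assms theta3_quarter [of "2 * \<tau>"] theta_constants_nonzero(3) [of "2 * \<tau>"]
      theta_constants_nonzero(3) [of "8 * \<tau>"] by simp
  then have nz: "theta3 (1 / 8) \<tau> \<noteq> 0" "theta3 (3 / 8) \<tau> \<noteq> 0" by auto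
  \<comment> \<open>Half the sum and half the difference of these two equations are the two claims, each
    multiplied by the nonzero value at the other point.\<close>
  note sys = theta3_eighths_wronskian [OF assms] theta3_eighths_product_deriv [OF assms]
  have "theta_deriv 0 0 (1 / 8) \<tau> * (2 * theta3 (3 / 8) \<tau>) =
      (- of_real pi * theta3 (1 / 8) \<tau> * theta2 0 (4 * \<tau>) *
        (of_real (sqrt 2) * theta3 0 (2 * \<tau>) - theta2 0 (4 * \<tau>))) * (2 * theta3 (3 / 8) \<tau>)"
    using sys by algebra
  moreover have "theta_deriv 0 0 (3 / 8) \<tau> * (2 * theta3 (1 / 8) \<tau>) =
      (- of_real pi * theta3 (3 / 8) \<tau> * theta2 0 (4 * \<tau>) *
        (of_real (sqrt 2) * theta3 0 (2 * \<tau>) + theta2 0 (4 * \<tau>))) * (2 * theta3 (1 / 8) \<tau>)"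
    using sys by algebra
  ultimately show ?thesis
    unfolding shift using nz mult_right_cancel
    by (metis mult_eq_0_iff zero_neq_numeral)
qed

end
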